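(* Let $\Lambda^*=(\mu^*,\alpha^*,\lambda^* )\in\mathcal{U}$ and suppose that $M(\Lambda^* )=\{n_1,\ldots,n_N\}$ (with the $n_i$ distinct). Then we may define $$\mu_i(\alpha,\lambda)=\frac{\operatorname{sgn}(\mu^* )}{|\alpha|^{1/2}\sin(\lambda)\big(l(n_i,\alpha)-|\alpha|^{1/2}\cot(\lambda)\big)^{1/2}},\qquad 1\le i\le N,$$ on a neighborhood of $(\alpha^*,\lambda^* )$, and $$\mu_*(\lambda)=\mu_1(\alpha^*,\lambda)\quad(=\cdots=\mu_N(\alpha^*,\lambda))$$ on a neighborhood of $\lambda^*$, and for all $\Lambda=(\mu,\alpha,\lambda)$ in a neighborhood of $\Lambda^*$ we have $$M(\Lambda)=\begin{cases} M(\Lambda^* ) & \text{if }\alpha=\alpha^*,\ \mu=\mu_*(\lambda),\\ \{n_i\} & \text{if }\alpha\neq\alpha^*,\ \mu=\mu_i(\alpha,\lambda),\\ \varnothing & \text{otherwise.}\end{cases}$$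
   Context: Fix $\kappa>0$. Let $\mathcal{U}=\{(\mu,\alpha,\lambda)\in\mathbb{R}^3:\mu\neq0,\ \alpha<0,\ 0<\lambda<\pi\}$. For $n\in\mathbb{N}_0$ and $\alpha<0$ set $\theta_n=\theta(n,\alpha)=\sqrt{\alpha+n^2\kappa^2}$, which equals $\sqrt{n^2\kappa^2-|\alpha|}$ if $n\ge|\alpha|^{1/2}/\kappa$ and $i\sqrt{|\alpha|-n^2\kappa^2}$ if $n<|\alpha|^{1/2}/\kappa$. Set $l(n,\alpha)=\theta_n\coth(\theta_n)$ (interpreted by continuity as $1$ when $\theta_n=0$, equal to $|\theta_n|\cot|\theta_n|$ when $\theta_n$ is imaginary, and well-defined whenever $\sinh(\theta_n)/\theta_n\neq0$, with $\sinh(\theta_n)/\theta_n:=1$ if $\theta_n=0$), and for $\Lambda=(\mu,\alpha,\lambda)\in\mathcal{U}$ set $$r(\Lambda)=\frac{1}{\mu^2|\alpha|\sin^2(\lambda)}+|\alpha|^{1/2}\cot(\lambda).$$ $M(\Lambda)$ is the (finite) set of all $n\in\mathbb{N}_0$ for which $l(n,\alpha)$ is well-defined and satisfies the kernel equation $l(n,\alpha)=r(\Lambda)$. *)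

theory Defs
  imports "HOL-Analysis.Analysis"
begin

definition \<U> :: "(real \<times> real \<times> real) set" where
  "\<U> = {(\<mu>, \<alpha>, lam). \<mu> \<noteq> 0 \<and> \<alpha> < 0 \<and> 0 < lam \<and> lam < pi}"

definition coth :: "'a \<Rightarrow> 'a::{banach, real_normed_field}" where
  "coth z = cosh z / sinh z"

text \<open>The principal branch gives the convention that \<open>\<theta>\<close> is a nonnegative real or a positive
  multiple of \<open>\<i>\<close>; see \<open>theta_nonneg\<close> and \<open>theta_neg\<close>.\<close>
definition theta :: "real \<Rightarrow> nat \<Rightarrow> real \<Rightarrow> complex" where
  "theta \<kappa> n \<alpha> = csqrt (of_real (\<alpha> + (real n)\<^sup>2 * \<kappa>\<^sup>2))"

definition ell_welldef :: "real \<Rightarrow> nat \<Rightarrow> real \<Rightarrow> bool" where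
  "ell_welldef \<kappa> n \<alpha> \<longleftrightarrow>
    (if theta \<kappa> n \<alpha> = 0 then 1 else sinh (theta \<kappa> n \<alpha>) / theta \<kappa> n \<alpha>) \<noteq> 0"

text \<open>\<open>\<theta> coth \<theta>\<close> is real for every \<open>\<theta>\<close> in question, so taking the real part only
  changes the type; see \<open>of_real_ell\<close>. Where \<open>ell_welldef\<close> fails the value is meaningless.\<close>
definition ell :: "real \<Rightarrow> nat \<Rightarrow> real \<Rightarrow> real" where
  "ell \<kappa> n \<alpha> =
    Re (if theta \<kappa> n \<alpha> = 0 then 1 else theta \<kappa> n \<alpha> * coth (theta \<kappa> n \<alpha>))"

definition r_fun :: "real \<times> real \<times> real \<Rightarrow> real" where
  "r_fun = (\<lambda>(\<mu>, \<alpha>, lam). 1 / (\<mu>\<^sup>2 * \<bar>\<alpha>\<bar> * (sin lam)\<^sup>2) + sqrt \<bar>\<alpha>\<bar> * cot lam)"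

definition M_set :: "real \<Rightarrow> real \<times> real \<times> real \<Rightarrow> nat set" where
  "M_set \<kappa> = (\<lambda>(\<mu>, \<alpha>, lam). {n. ell_welldef \<kappa> n \<alpha> \<and> ell \<kappa> n \<alpha> = r_fun (\<mu>, \<alpha>, lam)})"

text \<open>The curve belonging to the mode \<open>n\<close>; of the reference point only the sign of
  \<open>\<mu>s\<close> enters.\<close>
definition mu_mode :: "real \<Rightarrow> real \<Rightarrow> nat \<Rightarrow> real \<Rightarrow> real \<Rightarrow> real" where
  "mu_mode \<kappa> \<mu>s n \<alpha> lam =
    sgn \<mu>s / (sqrt \<bar>\<alpha>\<bar> * sin lam * sqrt (ell \<kappa> n \<alpha> - sqrt \<bar>\<alpha>\<bar> * cot lam))"

text \<open>The formula for \<open>mu_mode\<close> makes sense: \<open>ell\<close> is well-defined, the radicand is positive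
  and (by the first three conditions) the other factors of the denominator do not vanish.\<close>
definition mu_mode_welldef :: "real \<Rightarrow> nat \<Rightarrow> real \<Rightarrow> real \<Rightarrow> bool" where
  "mu_mode_welldef \<kappa> n \<alpha> lam \<longleftrightarrow>
    \<alpha> < 0 \<and> 0 < lam \<and> lam < pi \<and>
    ell_welldef \<kappa> n \<alpha> \<and> ell \<kappa> n \<alpha> - sqrt \<bar>\<alpha>\<bar> * cot lam > 0"

lemma theta_nonneg:
  "0 \<le> \<alpha> + (real n)\<^sup>2 * \<kappa>\<^sup>2 \<Longrightarrow> theta \<kappa> n \<alpha> = of_real (sqrt (\<alpha> + (real n)\<^sup>2 * \<kappa>\<^sup>2))"
  unfolding theta_def by (metis of_real_sqrt)

lemma theta_neg:
  assumes "\<alpha> + (real n)\<^sup>2 * \<kappa>\<^sup>2 < 0"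
  shows "theta \<kappa> n \<alpha> = \<i> * of_real (sqrt (- (\<alpha> + (real n)\<^sup>2 * \<kappa>\<^sup>2)))"
  unfolding theta_def using csqrt_of_real_nonpos[of "of_real (\<alpha> + (real n)\<^sup>2 * \<kappa>\<^sup>2)"] assms
  by simp

lemma i_coth_i: "(\<i> * of_real x) * coth (\<i> * of_real x) = (of_real (x * cot x) :: complex)"
proof -
  have "sinh (\<i> * of_real x) = \<i> * of_real (sin x)" "cosh (\<i> * of_real x) = of_real (cos x)"
    using sinh_conv_sin[of "\<i> * of_real x"] cosh_conv_cos[of "\<i> * of_real x"]
    by (simp_all add: sin_of_real cos_of_real flip: mult.assoc)
  then show ?thesis
    by (simp add: coth_def cot_def)
qed

lemma real_coth: "of_real x * coth (of_real x) = (of_real (x * coth x) :: complex)"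
  by (simp add: coth_def sinh_def cosh_def exp_of_real scaleR_conv_of_real flip: of_real_minus)

lemma of_real_ell:
  "of_real (ell \<kappa> n \<alpha>) =
    (if theta \<kappa> n \<alpha> = 0 then 1 else theta \<kappa> n \<alpha> * coth (theta \<kappa> n \<alpha>))"
proof (cases "0 \<le> \<alpha> + (real n)\<^sup>2 * \<kappa>\<^sup>2")
  case True
  show ?thesis unfolding ell_def theta_nonneg[OF True] real_coth by simp
next
  case False
  then have *: "\<alpha> + (real n)\<^sup>2 * \<kappa>\<^sup>2 < 0" by simp
  show ?thesis unfolding ell_def theta_neg[OF *] i_coth_i by simp
qed

lemma ell_neg:
  assumes "\<alpha> + (real n)\<^sup>2 * \<kappa>\<^sup>2 < 0"
  shows "ell \<kappa> n \<alpha> = cmod (theta \<kappa> n \<alpha>) * cot (cmod (theta \<kappa> n \<alpha>))"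
proof -
  have "cmod (theta \<kappa> n \<alpha>) = sqrt (- (\<alpha> + (real n)\<^sup>2 * \<kappa>\<^sup>2))"
    using assms by (simp add: theta_neg norm_mult del: minus_add_distrib)
  then show ?thesis
    unfolding ell_def theta_neg[OF assms] i_coth_i using assms by simp
qed

end

theory Submission
  imports Defs
begin

text \<open>Both \<open>cosh \<theta>\<close> and \<open>sinh \<theta> / \<theta>\<close> are entire functions of \<open>x = \<theta>\<^sup>2\<close>, real for real \<open>x\<close>; write
  them \<open>C x\<close> and \<open>S x\<close> (\<open>cosh_sqrt\<close> and \<open>sinhc_sqrt\<close> below). Since \<open>\<theta>(n, \<alpha>)\<^sup>2 = \<alpha> + n\<^sup>2\<kappa>\<^sup>2\<close>, all
  modes share the single function \<open>L = C / S\<close>, evaluated at shifts of \<open>\<alpha>\<close>, and the signs of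
  \<open>\<alpha> + n\<^sup>2\<kappa>\<^sup>2\<close> need not be distinguished. Because of \<open>C\<^sup>2 - x S\<^sup>2 = 1\<close> the functions \<open>C\<close> and \<open>S\<close>
  have no common zero, so \<open>n\<close> lies in \<open>M(\<Lambda>)\<close> if and only if \<open>C x = r(\<Lambda>) S x\<close> at \<open>x = \<alpha> + n\<^sup>2\<kappa>\<^sup>2\<close>
  (\<open>M_set_iff\<close>), an equation without poles.

  Three facts then give the theorem.

  No new modes appear near \<open>\<Lambda>\<^sup>*\<close> (\<open>eventually_M_set_subset\<close>): for one \<open>n\<close> the relation
  \<open>C x \<noteq> r S x\<close> persists by continuity, and for all large \<open>n\<close> at once it holds because
  \<open>L x > sqrt x\<close> exceeds the locally bounded \<open>r\<close>.

  For fixed \<open>n\<close>, \<open>\<alpha>\<close> and \<open>\<lambda>\<close> the kernel equation determines \<open>\<mu>\<^sup>2\<close>, hence \<open>\<mu>\<close> once its sign is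
  known; solving it gives the curve of the mode \<open>n\<close> (\<open>M_set_iff_mu_mode\<close>).

  Two modes that are both in \<open>M(\<Lambda>\<^sup>*)\<close> separate as soon as \<open>\<alpha>\<close> leaves \<open>\<alpha>\<^sup>*\<close>
  (\<open>zcoth_sqrt_shifts_separate\<close>). This rests on the Riccati equation \<open>2 x L' = L + x - L\<^sup>2\<close>.
  If \<open>L a = L b = c\<close> with \<open>a \<noteq> b\<close> both nonzero, then
  \<open>L' a - L' b = (c - c\<^sup>2) (1 / a - 1 / b) / 2\<close>, which is nonzero unless \<open>c\<close> is \<open>0\<close> or \<open>1\<close>. In these two
  cases \<open>L' a = L' b = 1 / 2\<close>, but the differentiated Riccati equation gives
  \<open>L'' x = (1 / 2 - c) / (2 x)\<close> at \<open>x = a\<close> and \<open>x = b\<close>, so the second derivatives differ. If one of the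
  points is \<open>0\<close>, then \<open>c = L 0 = 1\<close>, and \<open>L' 0 = 1 / 3\<close> differs from \<open>1 / 2\<close>. In every case the
  difference of the two shifts of \<open>L\<close> has an isolated zero.\<close>

section \<open>The hyperbolic functions of a square root\<close>

text \<open>Power series make the function entire without a choice of branch. The general type serves to
  pass from the complex \<open>\<theta>\<close> to real arguments.\<close>

definition cosh_sqrt :: "'a::{banach, real_normed_field} \<Rightarrow> 'a" where
  "cosh_sqrt x = (\<Sum>k. (1 / fact (2 * k)) * x ^ k)"

definition sinhc_sqrt :: "'a::{banach, real_normed_field} \<Rightarrow> 'a" where
  "sinhc_sqrt x = (\<Sum>k. (1 / fact (2 * k + 1)) * x ^ k)"

lemma summable_sparse_exp:
  fixes x :: "'a::{banach, real_normed_field}"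
  assumes "\<And>k. k \<le> m k"
  shows "summable (\<lambda>k. (1 / fact (m k)) * x ^ k)"
proof (rule summable_comparison_test')
  show "summable (\<lambda>k. norm x ^ k /\<^sub>R fact k)"
    by (rule summable_exp_generic)
  show "norm ((1 / fact (m k)) * x ^ k) \<le> norm x ^ k /\<^sub>R fact k" for k
  proof -
    have "(fact k :: real) \<le> fact (m k)"
      using assms by (rule fact_mono)
    then have "norm x ^ k / fact (m k) \<le> norm x ^ k / fact k"
      by (intro divide_left_mono) auto
    then show ?thesis
      by (simp add: norm_mult norm_divide norm_power divide_simps)
  qed
qed

lemma cosh_sqrt_summable: "summable (\<lambda>k. (1 / fact (2 * k)) * x ^ k)"
  for x :: "'a::{banach, real_normed_field}"
  by (rule summable_sparse_exp) auto

lemma sinhc_sqrt_summable: "summable (\<lambda>k. (1 / fact (2 * k + 1)) * x ^ k)"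
  for x :: "'a::{banach, real_normed_field}"
  by (rule summable_sparse_exp) auto

lemma cosh_sqrt_of_real:
  "cosh_sqrt (of_real x) = (of_real (cosh_sqrt x) :: 'a::{banach, real_normed_field})"
  unfolding cosh_sqrt_def suminf_of_real[OF cosh_sqrt_summable] by simp

lemma sinhc_sqrt_of_real:
  "sinhc_sqrt (of_real x) = (of_real (sinhc_sqrt x) :: 'a::{banach, real_normed_field})"
  unfolding sinhc_sqrt_def suminf_of_real[OF sinhc_sqrt_summable] by simp

lemma cosh_eq_cosh_sqrt: "cosh z = cosh_sqrt (z\<^sup>2)"
  for z :: "'a::{banach, real_normed_field}"
proof -
  have "(\<lambda>k. if even (2 * k) then z ^ (2 * k) /\<^sub>R fact (2 * k) else 0) sums cosh z"
    by (subst sums_mono_reindex[of "\<lambda>k. 2 * k"])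
       (use cosh_converges[of z] in \<open>auto simp: strict_mono_def elim!: evenE\<close>)
  then have "(\<lambda>k. (1 / fact (2 * k)) * (z\<^sup>2) ^ k) sums cosh z"
    by (simp add: scaleR_conv_of_real divide_inverse mult.commute flip: power_mult)
  then show ?thesis
    by (simp add: cosh_sqrt_def sums_iff)
qed

lemma sinh_eq_sinhc_sqrt: "sinh z = z * sinhc_sqrt (z\<^sup>2)"
  for z :: "'a::{banach, real_normed_field}"
proof -
  have "(\<lambda>k. if even (2 * k + 1) then 0 else z ^ (2 * k + 1) /\<^sub>R fact (2 * k + 1)) sums sinh z"
    by (subst sums_mono_reindex[of "\<lambda>k. 2 * k + 1"])
       (use sinh_converges[of z] in \<open>auto simp: strict_mono_def elim!: oddE\<close>)
  then have "(\<lambda>k. z * ((1 / fact (2 * k + 1)) * (z\<^sup>2) ^ k)) sums sinh z"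
    by (simp add: scaleR_conv_of_real divide_inverse mult_ac del: fact_Suc flip: power_mult)
  moreover have "(\<lambda>k. z * ((1 / fact (2 * k + 1)) * (z\<^sup>2) ^ k)) sums (z * sinhc_sqrt (z\<^sup>2))"
    unfolding sinhc_sqrt_def by (intro sums_mult summable_sums sinhc_sqrt_summable)
  ultimately show ?thesis
    by (rule sums_unique2)
qed

lemma sinhc_sqrt_0: "sinhc_sqrt 0 = (1 :: 'a::{banach, real_normed_field})"
  unfolding sinhc_sqrt_def by (subst powser_zero) simp

lemma cosh_sqrt_0: "cosh_sqrt 0 = (1 :: 'a::{banach, real_normed_field})"
  unfolding cosh_sqrt_def by (subst powser_zero) simp

text \<open>For negative \<open>x\<close> the square root is imaginary, so the identity is transferred from the complex
  hyperbolic functions.\<close>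
lemma pythagoras_sqrt: "(cosh_sqrt x)\<^sup>2 - x * (sinhc_sqrt x)\<^sup>2 = (1 :: real)"
proof -
  define z where "z = csqrt (of_real x)"
  have z: "z\<^sup>2 = of_real x"
    by (simp add: z_def)
  have "complex_of_real ((cosh_sqrt x)\<^sup>2 - x * (sinhc_sqrt x)\<^sup>2) = (cosh z)\<^sup>2 - (sinh z)\<^sup>2"
    unfolding cosh_eq_cosh_sqrt sinh_eq_sinhc_sqrt power_mult_distrib z
    by (simp add: cosh_sqrt_of_real sinhc_sqrt_of_real)
  also have "\<dots> = of_real 1"
    by (simp add: cosh_square_eq)
  finally show ?thesis
    by (simp only: of_real_eq_iff)
qed

lemma cosh_sqrt_deriv: "(cosh_sqrt has_real_derivative sinhc_sqrt x / 2) (at x)"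
proof -
  have "diffs (\<lambda>k. 1 / fact (2 * k)) = (\<lambda>k. 1 / 2 * (1 / fact (2 * k + 1)) :: real)"
  proof
    fix k
    have "(fact (2 * Suc k) :: real) = 2 * of_nat (Suc k) * fact (2 * k + 1)"
      by (simp add: algebra_simps)
    then show "diffs (\<lambda>k. 1 / fact (2 * k)) k = 1 / 2 * (1 / fact (2 * k + 1) :: real)"
      unfolding diffs_def by (simp del: fact_Suc of_nat_Suc)
  qed
  then have "(\<Sum>k. diffs (\<lambda>k. 1 / fact (2 * k)) k * x ^ k)
      = (\<Sum>k. 1 / 2 * ((1 / fact (2 * k + 1)) * x ^ k))"
    by simp
  also have "\<dots> = 1 / 2 * sinhc_sqrt x"
    unfolding sinhc_sqrt_def by (rule suminf_mult[OF sinhc_sqrt_summable])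
  finally have "(\<Sum>k. diffs (\<lambda>k. 1 / fact (2 * k)) k * x ^ k) = sinhc_sqrt x / 2"
    by simp
  then show ?thesis
    using termdiffs_strong_converges_everywhere[OF cosh_sqrt_summable, of x]
    by (simp only: cosh_sqrt_def[abs_def])
qed

definition sinhc_sqrt' :: "real \<Rightarrow> real" where
  "sinhc_sqrt' x = (\<Sum>k. diffs (\<lambda>k. 1 / fact (2 * k + 1)) k * x ^ k)"

lemma sinhc_sqrt_deriv: "(sinhc_sqrt has_real_derivative sinhc_sqrt' x) (at x)"
  using termdiffs_strong_converges_everywhere[OF sinhc_sqrt_summable, of x]
  by (simp add: sinhc_sqrt_def[abs_def] sinhc_sqrt'_def)

lemma sinhc_sqrt'_0: "sinhc_sqrt' 0 = 1 / 6"
  unfolding sinhc_sqrt'_def by (subst powser_zero) (simp add: diffs_def numeral_3_eq_3)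

text \<open>Differentiating \<open>pythagoras_sqrt\<close> gives this up to a factor \<open>sinhc_sqrt x\<close>.\<close>
lemma sinhc_sqrt'_eq:
  assumes "sinhc_sqrt x \<noteq> 0"
  shows "2 * x * sinhc_sqrt' x = cosh_sqrt x - sinhc_sqrt x"
proof -
  have "((\<lambda>x. (cosh_sqrt x)\<^sup>2 - x * (sinhc_sqrt x)\<^sup>2) has_real_derivative
      sinhc_sqrt x * (cosh_sqrt x - sinhc_sqrt x - 2 * x * sinhc_sqrt' x)) (at x)"
    by (rule derivative_eq_intros cosh_sqrt_deriv sinhc_sqrt_deriv refl)+
       (simp add: algebra_simps power2_eq_square)
  moreover have "((\<lambda>x. (cosh_sqrt x)\<^sup>2 - x * (sinhc_sqrt x)\<^sup>2) has_real_derivative 0) (at x)"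
    by (simp add: pythagoras_sqrt)
  ultimately show ?thesis
    using assms DERIV_unique by fastforce
qed

section \<open>The Riccati equation and the separation of shifts\<close>

definition zcoth_sqrt :: "real \<Rightarrow> real" where
  "zcoth_sqrt x = cosh_sqrt x / sinhc_sqrt x"

text \<open>The quotient rule for \<open>cosh_sqrt x / sinhc_sqrt x\<close>, arranged so that it also covers \<open>x = 0\<close>,
  where the Riccati equation degenerates.\<close>
definition zcoth_sqrt' :: "real \<Rightarrow> real" where
  "zcoth_sqrt' x = 1 / 2 - zcoth_sqrt x * sinhc_sqrt' x / sinhc_sqrt x"

lemma zcoth_sqrt_deriv:
  assumes "sinhc_sqrt x \<noteq> 0"
  shows "(zcoth_sqrt has_real_derivative zcoth_sqrt' x) (at x)"
  unfolding zcoth_sqrt_def[abs_def] zcoth_sqrt'_def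
  by (rule derivative_eq_intros cosh_sqrt_deriv sinhc_sqrt_deriv refl assms)+
     (use assms in \<open>simp add: field_simps power2_eq_square\<close>)

lemma zcoth_sqrt_riccati:
  assumes "sinhc_sqrt x \<noteq> 0" "x \<noteq> 0"
  shows "zcoth_sqrt' x = (zcoth_sqrt x + x - (zcoth_sqrt x)\<^sup>2) / (2 * x)"
proof -
  have C: "cosh_sqrt x = sinhc_sqrt x + 2 * x * sinhc_sqrt' x"
    using sinhc_sqrt'_eq[OF assms(1)] by simp
  show ?thesis
    unfolding zcoth_sqrt'_def zcoth_sqrt_def C
    using assms by (simp add: field_simps power2_eq_square)
qed

lemma zcoth_sqrt_0: "zcoth_sqrt 0 = 1"
  by (simp add: zcoth_sqrt_def cosh_sqrt_0 sinhc_sqrt_0)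

lemma zcoth_sqrt'_0: "zcoth_sqrt' 0 = 1 / 3"
  by (simp add: zcoth_sqrt'_def zcoth_sqrt_0 sinhc_sqrt'_0 sinhc_sqrt_0)

lemma eventually_sinhc_sqrt_nonzero:
  assumes "sinhc_sqrt (a::real) \<noteq> 0"
  shows "\<forall>\<^sub>F x in nhds a. sinhc_sqrt x \<noteq> 0"
  using DERIV_isCont[OF sinhc_sqrt_deriv] assms
  by (auto simp: isCont_def tendsto_at_iff_tendsto_nhds intro: tendsto_imp_eventually_ne)

lemma zcoth_sqrt'_deriv:
  assumes S: "sinhc_sqrt x \<noteq> 0" and x: "x \<noteq> 0"
  shows "(zcoth_sqrt' has_real_derivative
    (1 - zcoth_sqrt' x - 2 * zcoth_sqrt x * zcoth_sqrt' x) / (2 * x)) (at x)"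
proof -
  have riccati: "(zcoth_sqrt x)\<^sup>2 = zcoth_sqrt x + x - 2 * x * zcoth_sqrt' x"
    using zcoth_sqrt_riccati[OF S x] x by simp
  have "((\<lambda>x. (zcoth_sqrt x + x - (zcoth_sqrt x)\<^sup>2) / (2 * x)) has_real_derivative
      (1 - zcoth_sqrt' x - 2 * zcoth_sqrt x * zcoth_sqrt' x) / (2 * x)) (at x)"
    by (rule derivative_eq_intros zcoth_sqrt_deriv refl S)+
       (simp add: x, simp only: riccati, simp add: x divide_simps, algebra)
  moreover have "\<forall>\<^sub>F y in nhds x. y \<noteq> 0"
    using x by (intro t1_space_nhds)
  with eventually_sinhc_sqrt_nonzero[OF S]
  have "\<forall>\<^sub>F y in nhds x. zcoth_sqrt' y = (zcoth_sqrt y + y - (zcoth_sqrt y)\<^sup>2) / (2 * y)"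
    by eventually_elim (rule zcoth_sqrt_riccati)
  ultimately show ?thesis
    by (subst DERIV_cong_ev) auto
qed

lemma isolated_zero_of_deriv:
  fixes f :: "real \<Rightarrow> real"
  assumes "(f has_real_derivative D) (at a)" "f a = 0" "D \<noteq> 0"
  shows "\<forall>\<^sub>F x in at a. f x \<noteq> 0"
proof -
  have "((\<lambda>x. (f x - f a) / (x - a)) \<longlongrightarrow> D) (at a)"
    using assms(1) by (simp add: has_field_derivative_iff)
  then have "\<forall>\<^sub>F x in at a. (f x - f a) / (x - a) \<noteq> 0"
    using assms(3) by (rule tendsto_imp_eventually_ne)
  then show ?thesis
    by eventually_elim (use assms(2) in auto)
qed

text \<open>Near \<open>a\<close> the derivative vanishes only at \<open>a\<close>, so by the mean value theorem a second zero of \<open>f\<close>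
  is impossible.\<close>
lemma isolated_zero_of_deriv2:
  fixes f f' :: "real \<Rightarrow> real"
  assumes f: "\<forall>\<^sub>F x in nhds a. (f has_real_derivative f' x) (at x)"
    and f': "(f' has_real_derivative D) (at a)" "f' a = 0" "D \<noteq> 0"
    and "f a = 0"
  shows "\<forall>\<^sub>F x in at a. f x \<noteq> 0"
proof -
  have "\<forall>\<^sub>F x in nhds a. (f has_real_derivative f' x) (at x) \<and> (x \<noteq> a \<longrightarrow> f' x \<noteq> 0)"
    using f isolated_zero_of_deriv[OF f'] by (auto simp: eventually_at_filter eventually_conj_iff)
  then obtain e where "e > 0" and e: "\<And>x. dist x a < e \<Longrightarrow>
      (f has_real_derivative f' x) (at x) \<and> (x \<noteq> a \<longrightarrow> f' x \<noteq> 0)"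
    by (auto simp: eventually_nhds_metric)
  have "f x \<noteq> 0" if x: "x \<noteq> a" "dist x a < e" for x
  proof
    assume "f x = 0"
    have "\<exists>z. min x a < z \<and> z < max x a \<and>
        f (max x a) - f (min x a) = (max x a - min x a) * f' z"
    proof (rule MVT2)
      show "min x a < max x a" using x by auto
      show "(f has_real_derivative f' y) (at y)" if "min x a \<le> y" "y \<le> max x a" for y
        using e[of y] that x by (auto simp: dist_real_def min_def max_def split: if_splits)
    qed
    then obtain z where z: "min x a < z" "z < max x a"
        and eq: "f (max x a) - f (min x a) = (max x a - min x a) * f' z"
      by blast
    have "f' z = 0"
      using eq \<open>f x = 0\<close> \<open>f a = 0\<close> x by (auto simp: min_def max_def split: if_splits)
    moreover have "dist z a < e" "z \<noteq> a"
      using z x by (auto simp: dist_real_def min_def max_def split: if_splits)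
    ultimately show False
      using e[of z] by simp
  qed
  then show ?thesis
    using \<open>e > 0\<close> by (auto simp: eventually_at)
qed

text \<open>The derivatives of the two shifts at \<open>t\<close> are compared through the Riccati equation. Where
  they coincide, the common value of the shifts must be \<open>0\<close> or \<open>1\<close>, and then the second
  derivatives differ.\<close>
lemma zcoth_sqrt_shifts_separate:
  assumes S: "sinhc_sqrt (t + a) \<noteq> 0" "sinhc_sqrt (t + b) \<noteq> 0" and "a \<noteq> b"
    and eq: "zcoth_sqrt (t + a) = zcoth_sqrt (t + b)"
  shows "\<forall>\<^sub>F s in at t. zcoth_sqrt (s + a) \<noteq> zcoth_sqrt (s + b)"
proof -
  define d where "d = (\<lambda>s. zcoth_sqrt (s + a) - zcoth_sqrt (s + b))"
  define d' where "d' = (\<lambda>s. zcoth_sqrt' (s + a) - zcoth_sqrt' (s + b))"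
  define c where "c = zcoth_sqrt (t + a)"
  have shift: "\<forall>\<^sub>F s in nhds t. sinhc_sqrt (s + x) \<noteq> 0" if "sinhc_sqrt (t + x) \<noteq> 0" for x :: real
  proof -
    have "((\<lambda>s. s + x) \<longlongrightarrow> t + x) (nhds t)"
      by (intro tendsto_add tendsto_const filterlim_ident)
    then show ?thesis
      by (rule eventually_compose_filterlim[OF eventually_sinhc_sqrt_nonzero[OF that]])
  qed
  have d: "\<forall>\<^sub>F s in nhds t. (d has_real_derivative d' s) (at s)"
    using shift[OF S(1)] shift[OF S(2)]
  proof eventually_elim
    case (elim s)
    have "((\<lambda>s. zcoth_sqrt (s + a)) has_real_derivative zcoth_sqrt' (s + a)) (at s)"
         "((\<lambda>s. zcoth_sqrt (s + b)) has_real_derivative zcoth_sqrt' (s + b)) (at s)"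
      using zcoth_sqrt_deriv[OF elim(1)] zcoth_sqrt_deriv[OF elim(2)] by (simp_all add: DERIV_shift)
    then show ?case
      unfolding d_def d'_def by (rule DERIV_diff)
  qed
  have dt: "d t = 0"
    using eq by (simp add: d_def)
  have "\<forall>\<^sub>F s in at t. d s \<noteq> 0"
  proof (cases "d' t = 0")
    case False
    then show ?thesis
      using isolated_zero_of_deriv[OF eventually_nhds_x_imp_x[OF d] dt] by simp
  next
    case d't: True
    \<comment> \<open>If one of the two points were \<open>0\<close>, the common value would be \<open>1\<close>, and the derivatives would
      be \<open>1 / 3\<close> there and \<open>1 / 2\<close> at the other point.\<close>
    have half: "zcoth_sqrt' x = 1 / 2" if "sinhc_sqrt x \<noteq> 0" "x \<noteq> 0" "zcoth_sqrt x = 1" for x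
      using that by (simp add: zcoth_sqrt_riccati)
    have nz: "t + a \<noteq> 0" "t + b \<noteq> 0"
      using half[OF S(1)] half[OF S(2)] d't eq \<open>a \<noteq> b\<close>
      by (auto simp: d'_def zcoth_sqrt_0 zcoth_sqrt'_0)
    have "(c - c\<^sup>2) * ((t + b) - (t + a)) = 0"
      using d't nz S eq unfolding d'_def c_def
      by (simp add: zcoth_sqrt_riccati divide_simps) algebra
    then have c: "c = 0 \<or> c = 1"
      using \<open>a \<noteq> b\<close> by (auto simp: power2_eq_square)
    have D: "zcoth_sqrt' (t + a) = 1 / 2" "zcoth_sqrt' (t + b) = 1 / 2"
      using c nz S eq by (auto simp: zcoth_sqrt_riccati c_def)
    have "((\<lambda>s. zcoth_sqrt' (s + a)) has_real_derivative (1 / 2 - c) / (2 * (t + a))) (at t)"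
         "((\<lambda>s. zcoth_sqrt' (s + b)) has_real_derivative (1 / 2 - c) / (2 * (t + b))) (at t)"
      using zcoth_sqrt'_deriv[OF S(1) nz(1)] zcoth_sqrt'_deriv[OF S(2) nz(2)] D eq
      by (simp_all add: DERIV_shift c_def)
    then have "(d' has_real_derivative
        (1 / 2 - c) / (2 * (t + a)) - (1 / 2 - c) / (2 * (t + b))) (at t)"
      unfolding d'_def by (rule DERIV_diff)
    moreover have "(1 / 2 - c) / (2 * (t + a)) - (1 / 2 - c) / (2 * (t + b)) \<noteq> 0"
      using c nz \<open>a \<noteq> b\<close> by (auto simp: divide_simps)
    ultimately show ?thesis
      using isolated_zero_of_deriv2[OF d _ d't _ dt] by blast
  qed
  then show ?thesis
    by (simp add: d_def)
qed

section \<open>The kernel equation\<close>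

lemma ell_welldef_iff:
  "ell_welldef \<kappa> n \<alpha> \<longleftrightarrow> sinhc_sqrt (\<alpha> + (real n)\<^sup>2 * \<kappa>\<^sup>2) \<noteq> 0"
proof -
  define z where "z = theta \<kappa> n \<alpha>"
  have "z\<^sup>2 = of_real (\<alpha> + (real n)\<^sup>2 * \<kappa>\<^sup>2)"
    unfolding z_def theta_def by (rule power2_csqrt)
  then have "complex_of_real (sinhc_sqrt (\<alpha> + (real n)\<^sup>2 * \<kappa>\<^sup>2)) =
      (if z = 0 then 1 else sinh z / z)"
    by (auto simp: sinh_eq_sinhc_sqrt[of z] simp flip: sinhc_sqrt_of_real simp: sinhc_sqrt_0)
  then show ?thesis
    unfolding ell_welldef_def z_def[symmetric] by (metis of_real_eq_0_iff)
qed

lemma ell_eq_zcoth_sqrt: "ell \<kappa> n \<alpha> = zcoth_sqrt (\<alpha> + (real n)\<^sup>2 * \<kappa>\<^sup>2)"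
proof -
  define z where "z = theta \<kappa> n \<alpha>"
  have "z\<^sup>2 = of_real (\<alpha> + (real n)\<^sup>2 * \<kappa>\<^sup>2)"
    unfolding z_def theta_def by (rule power2_csqrt)
  then have "complex_of_real (zcoth_sqrt (\<alpha> + (real n)\<^sup>2 * \<kappa>\<^sup>2)) =
      (if z = 0 then 1 else z * coth z)"
    by (auto simp: sinh_eq_sinhc_sqrt[of z] cosh_eq_cosh_sqrt[of z] coth_def zcoth_sqrt_def
          sinhc_sqrt_0 cosh_sqrt_0 simp flip: sinhc_sqrt_of_real cosh_sqrt_of_real)
  then show ?thesis
    unfolding ell_def z_def[symmetric] by (metis Re_complex_of_real)
qed

text \<open>Where \<open>sinhc_sqrt\<close> vanishes, \<open>cosh_sqrt\<close> has modulus \<open>1\<close> by \<open>pythagoras_sqrt\<close>; so the equation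
  cleared of denominators fails there, in agreement with the exclusion of undefined values.\<close>
lemma M_set_iff:
  "n \<in> M_set \<kappa> (\<mu>, \<alpha>, lam) \<longleftrightarrow> cosh_sqrt (\<alpha> + (real n)\<^sup>2 * \<kappa>\<^sup>2)
     = r_fun (\<mu>, \<alpha>, lam) * sinhc_sqrt (\<alpha> + (real n)\<^sup>2 * \<kappa>\<^sup>2)"
  using pythagoras_sqrt[of "\<alpha> + (real n)\<^sup>2 * \<kappa>\<^sup>2"]
  by (auto simp: M_set_def ell_welldef_iff ell_eq_zcoth_sqrt zcoth_sqrt_def field_simps)

text \<open>This is \<open>z coth z > z\<close> for \<open>z = sqrt x > 0\<close>, which excludes all modes with large
  \<open>\<alpha> + n\<^sup>2\<kappa>\<^sup>2\<close>.\<close>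
lemma cosh_sqrt_gt:
  fixes x r :: real
  assumes "x > 0" "r < sqrt x"
  shows "r * sinhc_sqrt x < cosh_sqrt x"
proof -
  have C: "cosh_sqrt x = cosh (sqrt x)" and S: "sinh (sqrt x) = sqrt x * sinhc_sqrt x"
    using assms by (simp_all add: cosh_eq_cosh_sqrt sinh_eq_sinhc_sqrt)
  have "sinh (sqrt x) > 0"
    using assms by simp
  then have "sinhc_sqrt x > 0"
    using S assms by (simp add: zero_less_mult_iff)
  then have "r * sinhc_sqrt x < sqrt x * sinhc_sqrt x"
    using assms by simp
  also have "\<dots> = sinh (sqrt x)"
    by (simp add: S)
  also have "\<dots> < cosh_sqrt x"
    unfolding C by (rule sinh_less_cosh_real)
  finally show ?thesis .
qed

lemma tendsto_r_fun:
  assumes "(\<mu>s, \<alpha>s, lams) \<in> \<U>"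
  shows "(r_fun \<longlongrightarrow> r_fun (\<mu>s, \<alpha>s, lams)) (nhds (\<mu>s, \<alpha>s, lams))"
proof -
  have nz: "\<mu>s \<noteq> 0" "\<alpha>s \<noteq> 0" "sin lams \<noteq> 0"
    using assms by (auto simp: \<U>_def dest: sin_gt_zero)
  have "isCont (\<lambda>p. 1 / ((fst p)\<^sup>2 * \<bar>fst (snd p)\<bar> * (sin (snd (snd p)))\<^sup>2)
        + sqrt \<bar>fst (snd p)\<bar> * cot (snd (snd p))) (\<mu>s, \<alpha>s, lams)"
    using nz by (intro continuous_intros isCont_o2[OF _ isCont_cot]) auto
  then have "isCont r_fun (\<mu>s, \<alpha>s, lams)"
    by (simp add: r_fun_def case_prod_unfold)
  then show ?thesis
    by (simp add: isCont_def tendsto_at_iff_tendsto_nhds)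
qed

text \<open>Upper semicontinuity of the mode set. The neighborhood has to serve all \<open>n\<close> simultaneously:
  beyond an index \<open>m\<close>, chosen from bounds on \<open>\<alpha>\<close> and \<open>r\<close> near the reference point,
  \<open>cosh_sqrt_gt\<close> applies, and the finitely many remaining \<open>n\<close> are treated one by one.\<close>
lemma eventually_M_set_subset:
  assumes U: "(\<mu>s, \<alpha>s, lams) \<in> \<U>" and "\<kappa> > 0"
  shows "\<forall>\<^sub>F p in nhds (\<mu>s, \<alpha>s, lams). M_set \<kappa> p \<subseteq> M_set \<kappa> (\<mu>s, \<alpha>s, lams)"
proof -
  define F where "F = nhds (\<mu>s, \<alpha>s, lams)"
  define x where "x = (\<lambda>n \<alpha>. \<alpha> + (real n)\<^sup>2 * \<kappa>\<^sup>2)"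
  define R where "R = r_fun (\<mu>s, \<alpha>s, lams) + 1"
  have r: "(r_fun \<longlongrightarrow> r_fun (\<mu>s, \<alpha>s, lams)) F"
    unfolding F_def by (rule tendsto_r_fun[OF U])
  have id: "((\<lambda>p. p) \<longlongrightarrow> (\<mu>s, \<alpha>s, lams)) F"
    by (simp add: F_def filterlim_ident)
  have al: "((\<lambda>p. fst (snd p)) \<longlongrightarrow> \<alpha>s) F"
    using tendsto_fst[OF tendsto_snd[OF id]] by simp
  \<comment> \<open>Then \<open>x n \<alpha> > R\<^sup>2\<close> whenever \<open>n \<ge> m\<close> and \<open>\<alpha> > \<alpha>s - 1\<close>.\<close>
  obtain m where m: "\<And>n. n \<ge> m \<Longrightarrow> R\<^sup>2 + 1 - \<alpha>s < (real n)\<^sup>2 * \<kappa>\<^sup>2"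
  proof -
    have "filterlim (\<lambda>n. (real n)\<^sup>2 * \<kappa>\<^sup>2) at_top sequentially"
      using \<open>\<kappa> > 0\<close>
      by (intro filterlim_at_top_mult_tendsto_pos[OF tendsto_const] filterlim_pow_at_top
            filterlim_real_sequentially) auto
    then have "\<forall>\<^sub>F n in sequentially. R\<^sup>2 + 1 - \<alpha>s < (real n)\<^sup>2 * \<kappa>\<^sup>2"
      by (simp add: filterlim_at_top_dense)
    then show thesis
      using that by (auto simp: eventually_sequentially)
  qed
  have 1: "\<forall>\<^sub>F p in F. r_fun p < R"
    using r by (rule order_tendstoD) (simp add: R_def)
  have 2: "\<forall>\<^sub>F p in F. \<alpha>s - 1 < fst (snd p)"
    using al by (rule order_tendstoD) simp
  have 3: "\<forall>\<^sub>F p in F. \<forall>n\<in>{..<m} - M_set \<kappa> (\<mu>s, \<alpha>s, lams). n \<notin> M_set \<kappa> p"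
  proof (rule eventually_ball_finite; safe?)
    fix n assume n: "n \<notin> M_set \<kappa> (\<mu>s, \<alpha>s, lams)"
    have "((\<lambda>p. cosh_sqrt (x n (fst (snd p))) - r_fun p * sinhc_sqrt (x n (fst (snd p)))) \<longlongrightarrow>
        cosh_sqrt (x n \<alpha>s) - r_fun (\<mu>s, \<alpha>s, lams) * sinhc_sqrt (x n \<alpha>s)) F"
      unfolding x_def
      by (intro tendsto_intros r al isCont_tendsto_compose[OF DERIV_isCont[OF cosh_sqrt_deriv]]
            isCont_tendsto_compose[OF DERIV_isCont[OF sinhc_sqrt_deriv]])
    moreover have "cosh_sqrt (x n \<alpha>s) - r_fun (\<mu>s, \<alpha>s, lams) * sinhc_sqrt (x n \<alpha>s) \<noteq> 0"
      using n by (simp add: M_set_iff x_def)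
    ultimately have "\<forall>\<^sub>F p in F.
        cosh_sqrt (x n (fst (snd p))) - r_fun p * sinhc_sqrt (x n (fst (snd p))) \<noteq> 0"
      by (rule tendsto_imp_eventually_ne)
    then show "\<forall>\<^sub>F p in F. n \<notin> M_set \<kappa> p"
      by eventually_elim (auto simp: M_set_iff x_def)
  qed simp
  from 1 2 3 have "\<forall>\<^sub>F p in F. M_set \<kappa> p \<subseteq> M_set \<kappa> (\<mu>s, \<alpha>s, lams)"
  proof eventually_elim
    case (elim p)
    obtain \<mu> \<alpha> lam where p: "p = (\<mu>, \<alpha>, lam)"
      by (cases p)
    have "n \<notin> M_set \<kappa> p" if "n \<ge> m" for n
    proof -
      have x: "R\<^sup>2 < x n \<alpha>"
        using m[OF that] elim(2) by (simp add: x_def p)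
      then have "x n \<alpha> > 0"
        by (rule le_less_trans[rotated]) simp
      moreover have "r_fun p < sqrt (x n \<alpha>)"
        using elim(1) real_less_rsqrt[OF x] by simp
      ultimately show ?thesis
        using cosh_sqrt_gt[of "x n \<alpha>" "r_fun p"] by (simp add: p M_set_iff x_def)
    qed
    then show ?case
      using elim(3) by (meson DiffI lessThan_iff not_le subsetI)
  qed
  then show ?thesis
    by (simp add: F_def)
qed

lemma isCont_ell:
  assumes "ell_welldef \<kappa> n \<alpha>"
  shows "isCont (ell \<kappa> n) \<alpha>"
proof -
  have "isCont (\<lambda>\<alpha>. zcoth_sqrt (\<alpha> + (real n)\<^sup>2 * \<kappa>\<^sup>2)) \<alpha>"
    using assms unfolding ell_welldef_iff
    by (intro isCont_o2[OF _ DERIV_isCont[OF zcoth_sqrt_deriv]] continuous_intros)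
  then show ?thesis
    by (simp add: ell_eq_zcoth_sqrt[abs_def])
qed

section \<open>The curves of the modes\<close>

lemma M_set_iff_mu_mode:
  assumes W: "mu_mode_welldef \<kappa> n \<alpha> lam" and "\<mu> \<noteq> 0" and sgn: "sgn \<mu> = sgn \<mu>s"
  shows "n \<in> M_set \<kappa> (\<mu>, \<alpha>, lam) \<longleftrightarrow> \<mu> = mu_mode \<kappa> \<mu>s n \<alpha> lam"
proof -
  define s where "s = sqrt \<bar>\<alpha>\<bar> * sin lam"
  define q where "q = ell \<kappa> n \<alpha> - sqrt \<bar>\<alpha>\<bar> * cot lam"
  have "s > 0" "q > 0" and wd: "ell_welldef \<kappa> n \<alpha>"
    using W by (auto simp: mu_mode_welldef_def s_def q_def sin_gt_zero)
  have s2: "\<bar>\<alpha>\<bar> * (sin lam)\<^sup>2 = s\<^sup>2"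
    by (simp add: s_def power_mult_distrib)
  have "n \<in> M_set \<kappa> (\<mu>, \<alpha>, lam) \<longleftrightarrow> q = 1 / (\<mu>\<^sup>2 * s\<^sup>2)"
    using wd by (auto simp: M_set_def r_fun_def q_def mult.assoc s2)
  also have "\<dots> \<longleftrightarrow> (\<bar>\<mu>\<bar>)\<^sup>2 = (1 / (s * sqrt q))\<^sup>2"
    using \<open>s > 0\<close> \<open>q > 0\<close> \<open>\<mu> \<noteq> 0\<close> by (auto simp: field_simps power_mult_distrib)
  also have "\<dots> \<longleftrightarrow> \<bar>\<mu>\<bar> = 1 / (s * sqrt q)"
    using \<open>s > 0\<close> \<open>q > 0\<close> by (intro power2_eq_iff_nonneg) auto
  also have "\<dots> \<longleftrightarrow> \<mu> = sgn \<mu>s / (s * sqrt q)"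
    using \<open>\<mu> \<noteq> 0\<close> sgn by (auto simp: sgn_real_def abs_if split: if_splits)
  finally show ?thesis
    by (simp add: mu_mode_def s_def q_def)
qed

text \<open>On the kernel equation the radicand equals the first summand of \<open>r\<close>, which is positive.\<close>
lemma M_set_imp_mu_mode_welldef:
  assumes "(\<mu>, \<alpha>, lam) \<in> \<U>" "n \<in> M_set \<kappa> (\<mu>, \<alpha>, lam)"
  shows "mu_mode_welldef \<kappa> n \<alpha> lam"
proof -
  have "\<mu> \<noteq> 0" "\<alpha> \<noteq> 0" "sin lam \<noteq> 0"
    using assms(1) sin_gt_zero[of lam] by (auto simp: \<U>_def)
  then have "0 < 1 / (\<mu>\<^sup>2 * \<bar>\<alpha>\<bar> * (sin lam)\<^sup>2)"
    by simp
  then show ?thesis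
    using assms by (auto simp: M_set_def r_fun_def mu_mode_welldef_def \<U>_def)
qed

lemma eventually_mu_mode_welldef:
  assumes "mu_mode_welldef \<kappa> n \<alpha>s lams"
  shows "\<forall>\<^sub>F p in nhds (\<alpha>s, lams). mu_mode_welldef \<kappa> n (fst p) (snd p)"
proof -
  define F where "F = nhds (\<alpha>s, lams)"
  have wd: "ell_welldef \<kappa> n \<alpha>s" and pos: "\<alpha>s < 0" "0 < lams" "lams < pi"
      "0 < ell \<kappa> n \<alpha>s - sqrt \<bar>\<alpha>s\<bar> * cot lams"
    using assms by (auto simp: mu_mode_welldef_def)
  have "filterlim (\<lambda>p. p) (nhds (\<alpha>s, lams)) F"
    by (simp add: F_def filterlim_ident)
  then have lims: "(fst \<longlongrightarrow> \<alpha>s) F" "(snd \<longlongrightarrow> lams) F"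
    by (auto dest: tendsto_snd tendsto_fst)
  have "sin lams \<noteq> 0"
    using pos sin_gt_zero by force
  then have "((\<lambda>p. ell \<kappa> n (fst p) - sqrt \<bar>fst p\<bar> * cot (snd p)) \<longlongrightarrow>
      ell \<kappa> n \<alpha>s - sqrt \<bar>\<alpha>s\<bar> * cot lams) F"
    by (intro tendsto_intros lims isCont_tendsto_compose[OF isCont_ell[OF wd]]
          isCont_tendsto_compose[OF isCont_cot])
  then have 1: "\<forall>\<^sub>F p in F. 0 < ell \<kappa> n (fst p) - sqrt \<bar>fst p\<bar> * cot (snd p)"
    using pos(4) by (rule order_tendstoD)
  have "((\<lambda>p. sinhc_sqrt (fst p + (real n)\<^sup>2 * \<kappa>\<^sup>2)) \<longlongrightarrow>
      sinhc_sqrt (\<alpha>s + (real n)\<^sup>2 * \<kappa>\<^sup>2)) F"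
    by (intro tendsto_intros lims isCont_tendsto_compose[OF DERIV_isCont[OF sinhc_sqrt_deriv]])
  then have 2: "\<forall>\<^sub>F p in F. ell_welldef \<kappa> n (fst p)"
    using wd unfolding ell_welldef_iff by (rule tendsto_imp_eventually_ne)
  have "\<forall>\<^sub>F p in F. fst p < 0" "\<forall>\<^sub>F p in F. 0 < snd p" "\<forall>\<^sub>F p in F. snd p < pi"
    using lims pos by (auto dest: order_tendstoD)
  with 1 2 have "\<forall>\<^sub>F p in F. mu_mode_welldef \<kappa> n (fst p) (snd p)"
    by eventually_elim (simp add: mu_mode_welldef_def)
  then show ?thesis
    by (simp add: F_def)
qed

lemma eventually_ell_distinct:
  assumes "\<kappa> > 0" "k \<noteq> m" "ell_welldef \<kappa> k \<alpha>s" "ell_welldef \<kappa> m \<alpha>s"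
    and "ell \<kappa> k \<alpha>s = ell \<kappa> m \<alpha>s"
  shows "\<forall>\<^sub>F \<alpha> in nhds \<alpha>s. \<alpha> \<noteq> \<alpha>s \<longrightarrow> ell \<kappa> k \<alpha> \<noteq> ell \<kappa> m \<alpha>"
proof -
  have "(real k)\<^sup>2 * \<kappa>\<^sup>2 \<noteq> (real m)\<^sup>2 * \<kappa>\<^sup>2"
    using assms(1,2) by simp
  from zcoth_sqrt_shifts_separate[OF _ _ this, of \<alpha>s] show ?thesis
    using assms(3-5) by (simp add: ell_welldef_iff ell_eq_zcoth_sqrt eventually_at_filter)
qed

section \<open>The mode set near a reference point\<close>

theorem theorem3p4:
  fixes \<kappa> \<mu>s \<alpha>s lams :: real and N :: nat and n :: "nat \<Rightarrow> nat"
  assumes "\<kappa> > 0"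
    and "(\<mu>s, \<alpha>s, lams) \<in> \<U>"
    and "inj_on n {1..N}"
    and "M_set \<kappa> (\<mu>s, \<alpha>s, lams) = n ` {1..N}"
  shows "\<exists>(W :: (real \<times> real) set) (I :: real set) (V :: (real \<times> real \<times> real) set).
    open W \<and> (\<alpha>s, lams) \<in> W \<and>
    (\<forall>(\<alpha>, lam) \<in> W. \<forall>i\<in>{1..N}. mu_mode_welldef \<kappa> (n i) \<alpha> lam) \<and>
    open I \<and> lams \<in> I \<and>
    (\<forall>lam\<in>I. \<forall>i\<in>{1..N}. mu_mode_welldef \<kappa> (n i) \<alpha>s lam \<and>
       mu_mode \<kappa> \<mu>s (n 1) \<alpha>s lam = mu_mode \<kappa> \<mu>s (n i) \<alpha>s lam) \<and>
    open V \<and> (\<mu>s, \<alpha>s, lams) \<in> V \<and> V \<subseteq> \<U> \<and>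
    (\<forall>(\<mu>, \<alpha>, lam) \<in> V. (\<alpha>, lam) \<in> W \<and> lam \<in> I \<and>
       (\<alpha> = \<alpha>s \<and> \<mu> = mu_mode \<kappa> \<mu>s (n 1) \<alpha>s lam \<longrightarrow>
          M_set \<kappa> (\<mu>, \<alpha>, lam) = M_set \<kappa> (\<mu>s, \<alpha>s, lams)) \<and>
       (\<forall>i\<in>{1..N}. \<alpha> \<noteq> \<alpha>s \<and> \<mu> = mu_mode \<kappa> \<mu>s (n i) \<alpha> lam \<longrightarrow>
          M_set \<kappa> (\<mu>, \<alpha>, lam) = {n i}) \<and>
       (\<not> (\<alpha> = \<alpha>s \<and> \<mu> = mu_mode \<kappa> \<mu>s (n 1) \<alpha>s lam) \<and>
        \<not> (\<exists>i\<in>{1..N}. \<alpha> \<noteq> \<alpha>s \<and> \<mu> = mu_mode \<kappa> \<mu>s (n i) \<alpha> lam) \<longrightarrow>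
          M_set \<kappa> (\<mu>, \<alpha>, lam) = {}))"
proof -
  define \<Lambda>s where "\<Lambda>s = (\<mu>s, \<alpha>s, lams)"
  note U = assms(2) and Ms = assms(4)
  have mem: "n i \<in> M_set \<kappa> (\<mu>s, \<alpha>s, lams)" if "i \<in> {1..N}" for i
    using that Ms by blast
  have ell: "ell_welldef \<kappa> (n i) \<alpha>s" "ell \<kappa> (n i) \<alpha>s = r_fun (\<mu>s, \<alpha>s, lams)"
    if "i \<in> {1..N}" for i
    using mem[OF that] by (auto simp: M_set_def)
  \<comment> \<open>At \<open>\<alpha>s\<close> all modes of the reference point have the same \<open>ell\<close>, and the formula for the curve
    depends on the mode only through \<open>ell\<close>.\<close>
  have modes_agree: "mu_mode \<kappa> \<mu>s (n 1) \<alpha>s lam = mu_mode \<kappa> \<mu>s (n i) \<alpha>s lam"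
    if "i \<in> {1..N}" for i lam
    using that ell(2)[of i] ell(2)[of 1] by (simp add: mu_mode_def)
  have "\<forall>\<^sub>F p in nhds (\<alpha>s, lams). \<forall>i\<in>{1..N}. mu_mode_welldef \<kappa> (n i) (fst p) (snd p)"
    by (intro eventually_ball_finite ballI eventually_mu_mode_welldef
          M_set_imp_mu_mode_welldef[OF U] mem) auto
  then obtain W where W: "open W" "(\<alpha>s, lams) \<in> W"
      and wdW: "\<forall>p\<in>W. \<forall>i\<in>{1..N}. mu_mode_welldef \<kappa> (n i) (fst p) (snd p)"
    unfolding eventually_nhds by blast
  have wd: "mu_mode_welldef \<kappa> (n i) \<alpha> lam" if "(\<alpha>, lam) \<in> W" "i \<in> {1..N}" for \<alpha> lam i
    using wdW that by fastforce
  define I where "I = (\<lambda>lam. (\<alpha>s, lam)) -` W"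
  have I: "open I" "lams \<in> I"
    using W by (auto simp: I_def intro!: open_vimage continuous_intros)
  have id: "((\<lambda>p. p) \<longlongrightarrow> (\<mu>s, \<alpha>s, lams)) (nhds \<Lambda>s)"
    by (simp add: \<Lambda>s_def filterlim_ident)
  have lims: "(fst \<longlongrightarrow> \<mu>s) (nhds \<Lambda>s)" "(snd \<longlongrightarrow> (\<alpha>s, lams)) (nhds \<Lambda>s)"
      "((\<lambda>p. fst (snd p)) \<longlongrightarrow> \<alpha>s) (nhds \<Lambda>s)" "((\<lambda>p. snd (snd p)) \<longlongrightarrow> lams) (nhds \<Lambda>s)"
    using tendsto_fst[OF id] tendsto_snd[OF id] tendsto_fst[OF tendsto_snd[OF id]]
      tendsto_snd[OF tendsto_snd[OF id]] by simp_all
  have nearW: "\<forall>\<^sub>F p in nhds \<Lambda>s. snd p \<in> W"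
    using topological_tendstoD[OF lims(2) W] .
  have nearI: "\<forall>\<^sub>F p in nhds \<Lambda>s. snd (snd p) \<in> I"
    using topological_tendstoD[OF lims(4) I] .
  have near_sgn: "\<forall>\<^sub>F p in nhds \<Lambda>s. fst p \<noteq> 0 \<and> sgn (fst p) = sgn \<mu>s"
  proof (cases "\<mu>s > 0")
    case True
    then show ?thesis
      using order_tendstoD(1)[OF lims(1), of 0] by (auto elim!: eventually_mono)
  next
    case False
    then have "\<mu>s < 0"
      using U by (auto simp: \<U>_def)
    then show ?thesis
      using order_tendstoD(2)[OF lims(1), of 0] by (auto elim!: eventually_mono)
  qed
  have near_neg: "\<forall>\<^sub>F p in nhds \<Lambda>s. fst (snd p) < 0"
      "\<forall>\<^sub>F p in nhds \<Lambda>s. 0 < snd (snd p)" "\<forall>\<^sub>F p in nhds \<Lambda>s. snd (snd p) < pi"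
    using lims U by (auto simp: \<U>_def dest: order_tendstoD)
  have near_sub: "\<forall>\<^sub>F p in nhds \<Lambda>s. M_set \<kappa> p \<subseteq> n ` {1..N}"
    using eventually_M_set_subset[OF U assms(1)] by (simp add: \<Lambda>s_def Ms)
  have "\<forall>\<^sub>F \<alpha> in nhds \<alpha>s. n i \<noteq> n j \<longrightarrow> \<alpha> \<noteq> \<alpha>s \<longrightarrow> ell \<kappa> (n i) \<alpha> \<noteq> ell \<kappa> (n j) \<alpha>"
    if "i \<in> {1..N}" "j \<in> {1..N}" for i j
    using eventually_ell_distinct[OF assms(1) _ ell(1) ell(1)] ell(2) that
    by (cases "n i = n j") auto
  then have "\<forall>\<^sub>F \<alpha> in nhds \<alpha>s. \<forall>i\<in>{1..N}. \<forall>j\<in>{1..N}.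
      n i \<noteq> n j \<longrightarrow> \<alpha> \<noteq> \<alpha>s \<longrightarrow> ell \<kappa> (n i) \<alpha> \<noteq> ell \<kappa> (n j) \<alpha>"
    by (intro eventually_ball_finite ballI) auto
  then have near_distinct: "\<forall>\<^sub>F p in nhds \<Lambda>s. \<forall>i\<in>{1..N}. \<forall>j\<in>{1..N}. n i \<noteq> n j \<longrightarrow>
      fst (snd p) \<noteq> \<alpha>s \<longrightarrow> ell \<kappa> (n i) (fst (snd p)) \<noteq> ell \<kappa> (n j) (fst (snd p))"
    using lims(3) by (rule eventually_compose_filterlim)
  define good where "good = (\<lambda>(\<mu>, \<alpha>, lam). (\<alpha>, lam) \<in> W \<and> lam \<in> I \<and>
      (\<mu>, \<alpha>, lam) \<in> \<U> \<and> sgn \<mu> = sgn \<mu>s \<and> M_set \<kappa> (\<mu>, \<alpha>, lam) \<subseteq> n ` {1..N} \<and>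
      (\<forall>i\<in>{1..N}. \<forall>j\<in>{1..N}. n i \<noteq> n j \<longrightarrow> \<alpha> \<noteq> \<alpha>s \<longrightarrow> ell \<kappa> (n i) \<alpha> \<noteq> ell \<kappa> (n j) \<alpha>))"
  have "\<forall>\<^sub>F p in nhds \<Lambda>s. good p"
    using nearW nearI near_sgn near_neg near_sub near_distinct
    by eventually_elim (auto simp: good_def \<U>_def)
  then obtain V where V: "open V" "\<Lambda>s \<in> V" and good: "\<And>p. p \<in> V \<Longrightarrow> good p"
    by (auto simp: eventually_nhds)
  have V_cases: "(\<alpha> = \<alpha>s \<and> \<mu> = mu_mode \<kappa> \<mu>s (n 1) \<alpha>s lam \<longrightarrow>
          M_set \<kappa> (\<mu>, \<alpha>, lam) = M_set \<kappa> (\<mu>s, \<alpha>s, lams)) \<and>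
       (\<forall>i\<in>{1..N}. \<alpha> \<noteq> \<alpha>s \<and> \<mu> = mu_mode \<kappa> \<mu>s (n i) \<alpha> lam \<longrightarrow>
          M_set \<kappa> (\<mu>, \<alpha>, lam) = {n i}) \<and>
       (\<not> (\<alpha> = \<alpha>s \<and> \<mu> = mu_mode \<kappa> \<mu>s (n 1) \<alpha>s lam) \<and>
        \<not> (\<exists>i\<in>{1..N}. \<alpha> \<noteq> \<alpha>s \<and> \<mu> = mu_mode \<kappa> \<mu>s (n i) \<alpha> lam) \<longrightarrow>
          M_set \<kappa> (\<mu>, \<alpha>, lam) = {})" if "good (\<mu>, \<alpha>, lam)" for \<mu> \<alpha> lam
  proof -
    define M where "M = M_set \<kappa> (\<mu>, \<alpha>, lam)"
    have g: "(\<alpha>, lam) \<in> W" "\<mu> \<noteq> 0" "sgn \<mu> = sgn \<mu>s" and sub: "M \<subseteq> n ` {1..N}"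
      using that by (auto simp: good_def \<U>_def M_def)
    have mode: "n i \<in> M \<longleftrightarrow> \<mu> = mu_mode \<kappa> \<mu>s (n i) \<alpha> lam" if "i \<in> {1..N}" for i
      unfolding M_def by (rule M_set_iff_mu_mode[OF wd[OF g(1) that] g(2,3)])
    show ?thesis
    proof (cases "\<alpha> = \<alpha>s")
      case True
      have "n i \<in> M \<longleftrightarrow> \<mu> = mu_mode \<kappa> \<mu>s (n 1) \<alpha>s lam" if "i \<in> {1..N}" for i
        using mode[OF that] modes_agree[OF that] True by simp
      then have M: "M = {k \<in> n ` {1..N}. \<mu> = mu_mode \<kappa> \<mu>s (n 1) \<alpha>s lam}"
        using sub by fast
      show ?thesis
        unfolding M_def[symmetric] M Ms using True by simp
    next
      case False
      have distinct: "n i = n j" if "i \<in> {1..N}" "j \<in> {1..N}" "n i \<in> M" "n j \<in> M" for i j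
      proof -
        have "ell \<kappa> (n i) \<alpha> = ell \<kappa> (n j) \<alpha>"
          using that(3,4) by (simp add: M_def M_set_def)
        then show ?thesis
          using \<open>good (\<mu>, \<alpha>, lam)\<close> that(1,2) False unfolding good_def prod.case by blast
      qed
      have "M = {n i}" if i: "i \<in> {1..N}" "\<mu> = mu_mode \<kappa> \<mu>s (n i) \<alpha> lam" for i
      proof -
        have "n i \<in> M"
          using mode i by blast
        then show ?thesis
          using distinct[OF _ i(1)] sub by blast
      qed
      moreover have "M = {}" if "\<not> (\<exists>i\<in>{1..N}. \<mu> = mu_mode \<kappa> \<mu>s (n i) \<alpha> lam)"
        using mode sub that by blast
      ultimately show ?thesis
        unfolding M_def[symmetric] using False by blast
    qed
  qed
  show ?thesis
  proof (intro exI conjI)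
    show "\<forall>(\<alpha>, lam) \<in> W. \<forall>i\<in>{1..N}. mu_mode_welldef \<kappa> (n i) \<alpha> lam"
      using wd by blast
    show "\<forall>lam\<in>I. \<forall>i\<in>{1..N}. mu_mode_welldef \<kappa> (n i) \<alpha>s lam \<and>
       mu_mode \<kappa> \<mu>s (n 1) \<alpha>s lam = mu_mode \<kappa> \<mu>s (n i) \<alpha>s lam"
      using wd modes_agree by (simp add: I_def)
    show "open W" "(\<alpha>s, lams) \<in> W" "open I" "lams \<in> I" "open V" "(\<mu>s, \<alpha>s, lams) \<in> V"
      using W I V by (simp_all add: \<Lambda>s_def)
    show "V \<subseteq> \<U>"
      using good by (auto simp: good_def)
    show "\<forall>(\<mu>, \<alpha>, lam) \<in> V. (\<alpha>, lam) \<in> W \<and> lam \<in> I \<and>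
       (\<alpha> = \<alpha>s \<and> \<mu> = mu_mode \<kappa> \<mu>s (n 1) \<alpha>s lam \<longrightarrow>
          M_set \<kappa> (\<mu>, \<alpha>, lam) = M_set \<kappa> (\<mu>s, \<alpha>s, lams)) \<and>
       (\<forall>i\<in>{1..N}. \<alpha> \<noteq> \<alpha>s \<and> \<mu> = mu_mode \<kappa> \<mu>s (n i) \<alpha> lam \<longrightarrow>
          M_set \<kappa> (\<mu>, \<alpha>, lam) = {n i}) \<and>
       (\<not> (\<alpha> = \<alpha>s \<and> \<mu> = mu_mode \<kappa> \<mu>s (n 1) \<alpha>s lam) \<and>
        \<not> (\<exists>i\<in>{1..N}. \<alpha> \<noteq> \<alpha>s \<and> \<mu> = mu_mode \<kappa> \<mu>s (n i) \<alpha> lam) \<longrightarrow>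
          M_set \<kappa> (\<mu>, \<alpha>, lam) = {})"
        (is "\<forall>(\<mu>, \<alpha>, lam) \<in> V. ?claim \<mu> \<alpha> lam")
    proof (rule ballI)
      fix p assume "p \<in> V"
      obtain \<mu> \<alpha> lam where p: "p = (\<mu>, \<alpha>, lam)"
        by (cases p)
      have g: "good (\<mu>, \<alpha>, lam)"
        using good \<open>p \<in> V\<close> p by blast
      then have "(\<alpha>, lam) \<in> W" "lam \<in> I"
        by (simp_all add: good_def)
      with V_cases[OF g] show "case p of (\<mu>, \<alpha>, lam) \<Rightarrow> ?claim \<mu> \<alpha> lam"
        unfolding p prod.case by (intro conjI) simp_all
    qed
  qed
qed

end
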